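(* Let $\sigma,\breve\sigma,s\in\{-1,0,1\}$, let $g=\begin{pmatrix}a&b\\c&d\end{pmatrix}\in SL_2(\mathbb R)$ and let $(k,l,n,m)\in\mathbb R^4\setminus\{0\}$. Then the Möbius transformation of $\mathbb R^\sigma$ defined by $g$ transforms the cycle $$k(u^2-\sigma v^2)-2lu-2nv+m=0$$ into a cycle $$\tilde k(u^2-\sigma v^2)-2\tilde lu-2\tilde nv+\tilde m=0$$ whose coefficients satisfy, in $M_2(\mathcal{C}\ell(\breve\sigma))$, $$\begin{pmatrix}\tilde l\breve e_0+s\tilde n\breve e_1&\tilde m\\ \tilde k&-\tilde l\breve e_0-s\tilde n\breve e_1\end{pmatrix}=\begin{pmatrix}a&b\breve e_0\\-c\breve e_0&d\end{pmatrix}\begin{pmatrix}l\breve e_0+sn\breve e_1&m\\k&-l\breve e_0-sn\breve e_1\end{pmatrix}\begin{pmatrix}d&-b\breve e_0\\c\breve e_0&a\end{pmatrix},$$ that is, $\tilde C^s_{\breve\sigma}=g\,C^s_{\breve\sigma}\,g^{-1}$, for any choice of the Clifford algebras $\mathcal{C}\ell(\sigma)$ and $\mathcal{C}\ell(\breve\sigma)$.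
   Context: For $\sigma\in\{-1,0,1\}$, $\mathcal{C}\ell(\sigma)$ is the associative real algebra with basis $1,e_0,e_1,e_0e_1$ and relations $e_0^2=-1$, $e_1^2=\sigma$, $e_0e_1=-e_1e_0$. $\mathbb R^\sigma$ is the plane of vectors $w=ue_0+ve_1$, identified with points $(u,v)\in\mathbb R^2$. The algebra $\mathcal{C}\ell(\breve\sigma)$ is defined in the same way, with generators denoted $\breve e_0,\breve e_1$: $\breve e_0^2=-1$, $\breve e_1^2=\breve\sigma$; its signature is chosen independently of $\sigma$. The Möbius transformation of $\mathbb R^\sigma$ defined by $g=\begin{pmatrix}a&b\\c&d\end{pmatrix}\in SL_2(\mathbb R)$ is $w\mapsto g\cdot w=(aw+be_0)(-ce_0w+d)^{-1}$, defined whenever the denominator is invertible in $\mathcal{C}\ell(\sigma)$. Inside $M_2(\mathcal{C}\ell(\breve\sigma))$ the element $g$ is represented by $\begin{pmatrix}a&b\breve e_0\\-c\breve e_0&d\end{pmatrix}$. A cycle is the locus in $\mathbb R^\sigma$ given by $k(u^2-\sigma v^2)-2lu-2nv+m=0$ (equivalently $-k(e_0u+e_1v)^2-2\langle(l,n),(u,v)\rangle+m=0$), and $C^s_{\breve\sigma}=\begin{pmatrix}l\breve e_0+sn\breve e_1&m\\k&-l\breve e_0-sn\breve e_1\end{pmatrix}$ is the matrix associated with $(k,l,n,m)$. "Transforms the first cycle into the second" means: a point $w$ at which $g\cdot w$ is defined lies on the first cycle if and only if $g\cdot w$ lies on the second one. *)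

theory Defs
  imports "HOL-Analysis.Analysis"
begin

definition is_clifford :: "real \<Rightarrow> 'a::real_algebra_1 \<Rightarrow> 'a \<Rightarrow> bool" where
  "is_clifford \<sigma> e0 e1 \<longleftrightarrow>
     distinct [1, e0, e1, e0 * e1] \<and>
     independent {1, e0, e1, e0 * e1} \<and>
     span {1, e0, e1, e0 * e1} = UNIV \<and>
     e0 * e0 = -1 \<and> e1 * e1 = of_real \<sigma> \<and> e0 * e1 = - (e1 * e0)"

definition point :: "'a::real_algebra_1 \<Rightarrow> 'a \<Rightarrow> real \<Rightarrow> real \<Rightarrow> 'a" where
  "point e0 e1 u v = u *\<^sub>R e0 + v *\<^sub>R e1"

definition plane :: "'a::real_algebra_1 \<Rightarrow> 'a \<Rightarrow> 'a set" where
  "plane e0 e1 = {point e0 e1 u v | u v. True}"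

(* The algebra is not commutative and may have zero divisors, so the library's unit predicate
   (x dvd 1) and the inverse of division rings do not apply. *)
definition is_inverse :: "'a::ring_1 \<Rightarrow> 'a \<Rightarrow> bool" where
  "is_inverse x y \<longleftrightarrow> x * y = 1 \<and> y * x = 1"

definition has_inverse :: "'a::ring_1 \<Rightarrow> bool" where
  "has_inverse x \<longleftrightarrow> (\<exists>y. is_inverse x y)"

definition ring_inverse :: "'a::ring_1 \<Rightarrow> 'a" where
  "ring_inverse x = (THE y. is_inverse x y)"

definition mat2 :: "'a::zero \<Rightarrow> 'a \<Rightarrow> 'a \<Rightarrow> 'a \<Rightarrow> 'a^2^2" where
  "mat2 a b c d = vector [vector [a, b], vector [c, d]]"

definition moebius_denom :: "'a::real_algebra_1 \<Rightarrow> real^2^2 \<Rightarrow> 'a \<Rightarrow> 'a" where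
  "moebius_denom e0 g w = - (g$2$1) *\<^sub>R (e0 * w) + of_real (g$2$2)"

definition moebius :: "'a::real_algebra_1 \<Rightarrow> real^2^2 \<Rightarrow> 'a \<Rightarrow> 'a" where
  "moebius e0 g w =
     ((g$1$1) *\<^sub>R w + (g$1$2) *\<^sub>R e0) * ring_inverse (moebius_denom e0 g w)"

definition cycle :: "real \<Rightarrow> 'a::real_algebra_1 \<Rightarrow> 'a \<Rightarrow> real \<times> real \<times> real \<times> real \<Rightarrow> 'a set" where
  "cycle \<sigma> e0 e1 = (\<lambda>(k, l, n, m).
     {point e0 e1 u v | u v. k * (u\<^sup>2 - \<sigma> * v\<^sup>2) - 2 * l * u - 2 * n * v + m = 0})"

(* The membership in the plane is part of the assertion that g acts on the plane of vectors;
   the value of moebius is a priori only an element of the whole algebra. *)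
definition moebius_transforms ::
    "'a::real_algebra_1 \<Rightarrow> 'a \<Rightarrow> real^2^2 \<Rightarrow> 'a set \<Rightarrow> 'a set \<Rightarrow> bool" where
  "moebius_transforms e0 e1 g A B \<longleftrightarrow>
     (\<forall>w \<in> plane e0 e1. has_inverse (moebius_denom e0 g w) \<longrightarrow>
        moebius e0 g w \<in> plane e0 e1 \<and> (w \<in> A \<longleftrightarrow> moebius e0 g w \<in> B))"

definition clifford_rep :: "'a::real_algebra_1 \<Rightarrow> real^2^2 \<Rightarrow> 'a^2^2" where
  "clifford_rep e0 g =
     mat2 (of_real (g$1$1)) ((g$1$2) *\<^sub>R e0) (- (g$2$1) *\<^sub>R e0) (of_real (g$2$2))"

definition cycle_matrix ::
    "'a::real_algebra_1 \<Rightarrow> 'a \<Rightarrow> real \<Rightarrow> real \<times> real \<times> real \<times> real \<Rightarrow> 'a^2^2" where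
  "cycle_matrix e0 e1 s = (\<lambda>(k, l, n, m).
     mat2 (l *\<^sub>R e0 + (s * n) *\<^sub>R e1) (of_real m)
          (of_real k) (- (l *\<^sub>R e0) - (s * n) *\<^sub>R e1))"


text \<open>
  The following construction shows that \<^const>\<open>is_clifford\<close> is satisfiable for each of the three
  signatures. The type parameter carries the signature.
\<close>

class signature =
  fixes sig :: "'a itself \<Rightarrow> real"

datatype elliptic = Elliptic
datatype parabolic = Parabolic
datatype hyperbolic = Hyperbolic

instantiation elliptic :: signature
begin
definition "sig (_ :: elliptic itself) = (-1 :: real)"
instance ..
end

instantiation parabolic :: signature
begin
definition "sig (_ :: parabolic itself) = (0 :: real)"
instance ..
end

instantiation hyperbolic :: signature
begin
definition "sig (_ :: hyperbolic itself) = (1 :: real)"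
instance ..
end

(* coordinates with respect to 1, e0, e1, e0 * e1 *)
datatype 's cl = Cl (c1: real) (c2: real) (c3: real) (c4: real)

instantiation cl :: (signature) real_algebra_1
begin

definition "0 = Cl 0 0 0 0"
definition "1 = Cl 1 0 0 0"
definition "x + y = Cl (c1 x + c1 y) (c2 x + c2 y) (c3 x + c3 y) (c4 x + c4 y)"
definition "- x = Cl (- c1 x) (- c2 x) (- c3 x) (- c4 x)"
definition "x - y = Cl (c1 x - c1 y) (c2 x - c2 y) (c3 x - c3 y) (c4 x - c4 y)"
definition "r *\<^sub>R x = Cl (r * c1 x) (r * c2 x) (r * c3 x) (r * c4 x)"
definition
  "(x :: 'a cl) * y = (let \<sigma> = sig TYPE('a) in
     Cl (c1 x * c1 y - c2 x * c2 y + \<sigma> * c3 x * c3 y + \<sigma> * c4 x * c4 y)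
        (c1 x * c2 y + c2 x * c1 y - \<sigma> * c3 x * c4 y + \<sigma> * c4 x * c3 y)
        (c1 x * c3 y + c3 x * c1 y - c2 x * c4 y + c4 x * c2 y)
        (c1 x * c4 y + c4 x * c1 y + c2 x * c3 y - c3 x * c2 y))"

lemmas cl_defs = zero_cl_def one_cl_def plus_cl_def uminus_cl_def minus_cl_def
  scaleR_cl_def times_cl_def Let_def

instance
  by standard (auto simp: cl_defs algebra_simps cl.expand)

end

lemma is_clifford_cl:
  "is_clifford (sig TYPE('s)) (Cl 0 1 0 0 :: 's::signature cl) (Cl 0 0 1 0)"
proof -
  have e: "(Cl 0 1 0 0 :: 's cl) * Cl 0 0 1 0 = Cl 0 0 0 1"
    by (simp add: cl_defs)
  have sp: "x \<in> span {1, Cl 0 1 0 0, Cl 0 0 1 0, Cl 0 0 0 1}" for x :: "'s cl"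
  proof -
    have "x = c1 x *\<^sub>R 1 + c2 x *\<^sub>R Cl 0 1 0 0 + c3 x *\<^sub>R Cl 0 0 1 0 + c4 x *\<^sub>R Cl 0 0 0 1"
      by (simp add: cl_defs)
    then show ?thesis
      by (metis (no_types, lifting) span_add span_scale span_base insertI1 insertI2)
  qed
  have ind: "independent {1, Cl 0 1 0 0, Cl 0 0 1 0, Cl 0 0 0 1 :: 's cl}"
    by (simp add: independent_insert span_insert span_breakdown_eq) (auto simp: cl_defs)
  show ?thesis
    unfolding is_clifford_def e using ind sp
    by (auto simp: cl_defs of_real_def)
qed

lemma is_clifford_satisfiable:
  "is_clifford (-1) (Cl 0 1 0 0 :: elliptic cl) (Cl 0 0 1 0)"
  "is_clifford 0 (Cl 0 1 0 0 :: parabolic cl) (Cl 0 0 1 0)"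
  "is_clifford 1 (Cl 0 1 0 0 :: hyperbolic cl) (Cl 0 0 1 0)"
  using is_clifford_cl[where 's = elliptic] is_clifford_cl[where 's = parabolic]
    is_clifford_cl[where 's = hyperbolic]
  by (simp_all add: sig_elliptic_def sig_parabolic_def sig_hyperbolic_def)

end

theory Submission
  imports Defs
begin

text \<open>
  The denominator of the transformation lies in the even subalgebra, where it is inverted by its
  conjugate and its norm \<open>N = (c u + d)\<^sup>2 - \<sigma> (c v)\<^sup>2\<close>. This makes the action explicit on
  coordinates, and the transformed quadratic form, evaluated at the image of a point and
  multiplied by \<open>N\<close>, is the original form at that point. The conjugated matrix has the same
  coefficients for every \<open>\<sigma>'\<close> because its computation never squares \<open>f1\<close>.
\<close>

section \<open>Two-by-two matrices and two-sided inverses\<close>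

lemma mat2_mult:
  "mat2 a b c d ** mat2 a' b' c' d' =
     mat2 (a * a' + b * c') (a * b' + b * d') (c * a' + d * c') (c * b' + d * d')"
  by (simp add: mat2_def matrix_matrix_mult_def vec_eq_iff forall_2 sum_2)

lemma mat2_eq_iff: "mat2 a b c d = mat2 a' b' c' d' \<longleftrightarrow> a = a' \<and> b = b' \<and> c = c' \<and> d = d'"
  by (auto simp: mat2_def vec_eq_iff forall_2)

lemma mat2_one: "mat2 1 0 0 1 = mat 1"
  by (simp add: mat2_def mat_def vec_eq_iff forall_2)

lemma mat2_nth:
  "mat2 a b c d $ 1 $ 1 = a" "mat2 a b c d $ 1 $ 2 = b"
  "mat2 a b c d $ 2 $ 1 = c" "mat2 a b c d $ 2 $ 2 = d"
  by (simp_all add: mat2_def)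

text \<open>\<open>matrix_inv\<close> chooses some two-sided inverse. Associativity alone forces
  uniqueness, so the entries may come from a noncommutative Clifford algebra.\<close>

lemma matrix_inv_eqI:
  fixes A B :: "'a::semiring_1^'n^'n"
  assumes "A ** B = mat 1" "B ** A = mat 1"
  shows "matrix_inv A = B"
proof -
  have inv: "A ** matrix_inv A = mat 1 \<and> matrix_inv A ** A = mat 1"
    unfolding matrix_inv_def by (rule someI [of _ B]) (simp add: assms)
  have "matrix_inv A = (B ** A) ** matrix_inv A"
    by (simp add: assms)
  also have "\<dots> = B ** (A ** matrix_inv A)"
    by (rule matrix_mul_assoc [symmetric])
  finally show ?thesis
    by (simp add: inv)
qed

lemma ring_inverse_eqI:
  assumes "is_inverse x y"
  shows "ring_inverse x = y"
  unfolding ring_inverse_def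
proof (rule the_equality)
  fix z assume "is_inverse x z"
  then have "z = (y * x) * z"
    using assms by (simp add: is_inverse_def)
  also have "\<dots> = y * (x * z)"
    by (rule mult.assoc)
  finally show "z = y"
    using \<open>is_inverse x z\<close> by (simp add: is_inverse_def)
qed (fact assms)

section \<open>Arithmetic in the Clifford algebra\<close>

text \<open>As rewrite rules these move \<open>e0\<close> to the left of \<open>e1\<close> and
  remove squares. The versions with a trailing \<open>x\<close> reach inside right-nested
  products.\<close>

lemma clifford_mult:
  assumes "is_clifford \<sigma> e0 e1"
  shows "e0 * e0 = -1" "e1 * e1 = of_real \<sigma>" "e1 * e0 = - (e0 * e1)"
    "e0 * (e0 * x) = - x" "e1 * (e1 * x) = \<sigma> *\<^sub>R x" "e1 * (e0 * x) = - (e0 * (e1 * x))"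
proof -
  show *: "e0 * e0 = -1" "e1 * e1 = of_real \<sigma>" "e1 * e0 = - (e0 * e1)"
    using assms by (auto simp: is_clifford_def)
  show "e0 * (e0 * x) = - x" "e1 * (e1 * x) = \<sigma> *\<^sub>R x" "e1 * (e0 * x) = - (e0 * (e1 * x))"
    by (simp_all add: * mult.assoc [symmetric] of_real_def)
qed

lemma clifford_even_eq_0:
  assumes "is_clifford \<sigma> e0 e1" and eq: "x *\<^sub>R 1 + y *\<^sub>R (e0 * e1) = 0"
  shows "x = 0 \<and> y = 0"
proof -
  \<comment> \<open>Independence of a set says nothing about coinciding members, so this comes from
    \<open>distinct\<close>.\<close>
  have "1 \<noteq> e0 * e1"
    using assms(1) unfolding is_clifford_def by auto
  moreover have "independent {1, e0, e1, e0 * e1}"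
    using assms(1) unfolding is_clifford_def by blast
  then have "independent {1, e0 * e1}"
    by (rule independent_mono) blast
  ultimately have ind: "1 \<notin> span {e0 * e1}" and nz: "e0 * e1 \<noteq> 0"
    using independent_insert [of 1 "{e0 * e1}"] dependent_zero [of "{1, e0 * e1}"]
    by (simp, metis insertCI)
  have "x = 0"
  proof (rule ccontr)
    assume "x \<noteq> 0"
    have "x *\<^sub>R 1 = (- y) *\<^sub>R (e0 * e1)"
      using eq by (simp add: eq_neg_iff_add_eq_0)
    then have "(1 / x) *\<^sub>R (x *\<^sub>R 1) = (1 / x) *\<^sub>R ((- y) *\<^sub>R (e0 * e1))"
      by simp
    then have "1 = (- y / x) *\<^sub>R (e0 * e1)"
      using \<open>x \<noteq> 0\<close> by simp
    then show False
      using ind by (metis span_base span_scale singletonI)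
  qed
  with eq nz show ?thesis by simp
qed

lemma moebius_denom_point:
  assumes "is_clifford \<sigma> e0 e1"
  shows "moebius_denom e0 (mat2 a b c d) (point e0 e1 u v) =
           (c * u + d) *\<^sub>R 1 - (c * v) *\<^sub>R (e0 * e1)"
  by (simp add: moebius_denom_def point_def mat2_nth clifford_mult [OF assms] of_real_def
      algebra_simps)

text \<open>Anticommutation gives \<open>(e0 * e1) * (e0 * e1) = of_real \<sigma>\<close>. Both
  orders are recorded because \<open>is_inverse\<close> is two-sided.\<close>

lemma clifford_even_norm:
  assumes "is_clifford \<sigma> e0 e1"
  shows "(x *\<^sub>R 1 - y *\<^sub>R (e0 * e1)) * (x *\<^sub>R 1 + y *\<^sub>R (e0 * e1)) = (x\<^sup>2 - \<sigma> * y\<^sup>2) *\<^sub>R 1"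
    and "(x *\<^sub>R 1 + y *\<^sub>R (e0 * e1)) * (x *\<^sub>R 1 - y *\<^sub>R (e0 * e1)) = (x\<^sup>2 - \<sigma> * y\<^sup>2) *\<^sub>R 1"
  by (simp_all add: clifford_mult [OF assms] of_real_def algebra_simps power2_eq_square)

section \<open>The action on points and on cycles\<close>

lemma moebius_point:
  assumes cl: "is_clifford \<sigma> e0 e1" and det: "a * d - b * c = 1"
    and inv: "has_inverse (moebius_denom e0 (mat2 a b c d) (point e0 e1 u v))"
  defines "N \<equiv> (c * u + d)\<^sup>2 - \<sigma> * (c * v)\<^sup>2"
  shows "N \<noteq> 0"
    and "moebius e0 (mat2 a b c d) (point e0 e1 u v) =
           point e0 e1 (((a * u + b) * (c * u + d) - \<sigma> * a * c * v\<^sup>2) / N) (v / N)"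
proof -
  define D where "D = (c * u + d) *\<^sub>R 1 - (c * v) *\<^sub>R (e0 * e1)"
  define D' where "D' = (c * u + d) *\<^sub>R 1 + (c * v) *\<^sub>R (e0 * e1)"
  have DD: "D * D' = N *\<^sub>R 1" "D' * D = N *\<^sub>R 1"
    unfolding D_def D'_def N_def by (simp_all only: clifford_even_norm [OF cl])
  have den: "moebius_denom e0 (mat2 a b c d) (point e0 e1 u v) = D"
    unfolding D_def by (rule moebius_denom_point [OF cl])
  obtain z where z: "D * z = 1" "z * D = 1"
    using inv by (auto simp: den has_inverse_def is_inverse_def)
  show N: "N \<noteq> 0"
  proof
    \<comment> \<open>An invertible \<open>D\<close> is no zero divisor, so
      \<open>D * D' = 0\<close> kills the conjugate \<open>D'\<close>, hence its coordinates, hence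
      \<open>D\<close> itself.\<close>
    assume "N = 0"
    then have "z * (D * D') = 0"
      by (simp add: DD)
    then have "D' = 0"
      by (simp add: mult.assoc [symmetric] z)
    then have "c * u + d = 0 \<and> c * v = 0"
      unfolding D'_def by (rule clifford_even_eq_0 [OF cl])
    then have "D = 0"
      by (simp add: D_def)
    with z show False by simp
  qed
  have "is_inverse D ((1 / N) *\<^sub>R D')"
    using N by (simp add: is_inverse_def DD)
  then have inv_D: "ring_inverse D = (1 / N) *\<^sub>R D'"
    by (rule ring_inverse_eqI)
  \<comment> \<open>A vector times an even element is again a vector, which is why the image stays
    in the plane.\<close>
  have "(a *\<^sub>R point e0 e1 u v + b *\<^sub>R e0) * D' =
      point e0 e1 ((a * u + b) * (c * u + d) - \<sigma> * a * c * v\<^sup>2)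
        (a * v * (c * u + d) - (a * u + b) * c * v)"
    by (simp add: D'_def point_def clifford_mult [OF cl] of_real_def algebra_simps
        power2_eq_square)
  also have "a * v * (c * u + d) - (a * u + b) * c * v = v"
    using det by algebra
  finally show "moebius e0 (mat2 a b c d) (point e0 e1 u v) =
      point e0 e1 (((a * u + b) * (c * u + d) - \<sigma> * a * c * v\<^sup>2) / N) (v / N)"
    by (simp add: moebius_def den inv_D mat2_nth) (simp add: point_def scaleR_right_distrib)
qed

lemma point_eq_iff:
  assumes "is_clifford \<sigma> e0 e1"
  shows "point e0 e1 u v = point e0 e1 u' v' \<longleftrightarrow> u = u' \<and> v = v'"
proof
  assume "point e0 e1 u v = point e0 e1 u' v'"
  \<comment> \<open>Multiplying by \<open>e0\<close> moves the difference into the span of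
    \<open>1\<close> and \<open>e0 * e1\<close>, where \<open>clifford_even_eq_0\<close>
    applies.\<close>
  then have "e0 * point e0 e1 (u - u') (v - v') = 0"
    by (simp add: point_def algebra_simps)
  then have "(- (u - u')) *\<^sub>R 1 + (v - v') *\<^sub>R (e0 * e1) = 0"
    by (simp add: point_def clifford_mult [OF assms] algebra_simps)
  from clifford_even_eq_0 [OF assms this] show "u = u' \<and> v = v'"
    by simp
qed simp

lemma point_in_cycle_iff:
  assumes "is_clifford \<sigma> e0 e1"
  shows "point e0 e1 u v \<in> cycle \<sigma> e0 e1 (k, l, n, m) \<longleftrightarrow>
    k * (u\<^sup>2 - \<sigma> * v\<^sup>2) - 2 * l * u - 2 * n * v + m = 0"
  by (auto simp: cycle_def point_eq_iff [OF assms])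

text \<open>Here \<open>k, l, m\<close> change like the binary quadratic form
  \<open>k x^2 - 2 l x y + m y^2\<close> under substitution by the inverse matrix. No signature
  enters.\<close>

definition moebius_cycle ::
    "real \<Rightarrow> real \<Rightarrow> real \<Rightarrow> real \<Rightarrow> real \<times> real \<times> real \<times> real \<Rightarrow> real \<times> real \<times> real \<times> real" where
  "moebius_cycle a b c d = (\<lambda>(k, l, n, m).
     (d\<^sup>2 * k + 2 * c * d * l + c\<^sup>2 * m,
      b * d * k + (a * d + b * c) * l + a * c * m,
      n,
      b\<^sup>2 * k + 2 * a * b * l + a\<^sup>2 * m))"

text \<open>Each coefficient comes back multiplied by a power of the determinant. Invertibility is
  what keeps a nonzero cycle nonzero.\<close>

lemma moebius_cycle_inverse:
  assumes "a * d - b * c = 1"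
  shows "moebius_cycle d (- b) (- c) a (moebius_cycle a b c d C) = C"
proof (cases C)
  case (fields k l n m)
  have "a\<^sup>2 * (d\<^sup>2 * k + 2 * c * d * l + c\<^sup>2 * m)
      + 2 * (- c) * a * (b * d * k + (a * d + b * c) * l + a * c * m)
      + (- c)\<^sup>2 * (b\<^sup>2 * k + 2 * a * b * l + a\<^sup>2 * m) = k"
    using assms by algebra
  moreover have "(- b) * a * (d\<^sup>2 * k + 2 * c * d * l + c\<^sup>2 * m)
      + (d * a + (- b) * (- c)) * (b * d * k + (a * d + b * c) * l + a * c * m)
      + d * (- c) * (b\<^sup>2 * k + 2 * a * b * l + a\<^sup>2 * m) = l"
    using assms by algebra
  moreover have "(- b)\<^sup>2 * (d\<^sup>2 * k + 2 * c * d * l + c\<^sup>2 * m)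
      + 2 * d * (- b) * (b * d * k + (a * d + b * c) * l + a * c * m)
      + d\<^sup>2 * (b\<^sup>2 * k + 2 * a * b * l + a\<^sup>2 * m) = m"
    using assms by algebra
  ultimately show ?thesis
    by (simp add: moebius_cycle_def fields)
qed

lemma moebius_transforms_cycle:
  assumes cl: "is_clifford \<sigma> e0 e1" and det: "a * d - b * c = 1"
  shows "moebius_transforms e0 e1 (mat2 a b c d)
    (cycle \<sigma> e0 e1 C) (cycle \<sigma> e0 e1 (moebius_cycle a b c d C))"
proof -
  obtain k l n m where C: "C = (k, l, n, m)"
    by (cases C)
  have "moebius e0 (mat2 a b c d) (point e0 e1 u v) \<in> plane e0 e1 \<and>
      (point e0 e1 u v \<in> cycle \<sigma> e0 e1 C \<longleftrightarrow>
       moebius e0 (mat2 a b c d) (point e0 e1 u v) \<in> cycle \<sigma> e0 e1 (moebius_cycle a b c d C))"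
    if inv: "has_inverse (moebius_denom e0 (mat2 a b c d) (point e0 e1 u v))" for u v
  proof -
    define N where "N = (c * u + d)\<^sup>2 - \<sigma> * (c * v)\<^sup>2"
    define u' where "u' = ((a * u + b) * (c * u + d) - \<sigma> * a * c * v\<^sup>2) / N"
    define v' where "v' = v / N"
    have N: "N \<noteq> 0" and g: "moebius e0 (mat2 a b c d) (point e0 e1 u v) = point e0 e1 u' v'"
      using moebius_point [OF cl det inv] by (simp_all add: N_def u'_def v'_def)
    have u': "u' * N = (a * u + b) * (c * u + d) - \<sigma> * a * c * v\<^sup>2" and v': "v' * N = v"
      using N by (simp_all add: u'_def v'_def)
    \<comment> \<open>Multiplicativity of the norm: the numerator times \<open>D'\<close> has norm
      \<open>N\<close> times that of the numerator, and one \<open>N\<close> cancels.\<close>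
    have "N * (N * (u'\<^sup>2 - \<sigma> * v'\<^sup>2)) = (u' * N)\<^sup>2 - \<sigma> * (v' * N)\<^sup>2"
      by algebra
    also have "\<dots> = N * ((a * u + b)\<^sup>2 - \<sigma> * (a * v)\<^sup>2)"
      unfolding u' v' unfolding N_def using det by algebra
    finally have norm: "N * (u'\<^sup>2 - \<sigma> * v'\<^sup>2) = (a * u + b)\<^sup>2 - \<sigma> * (a * v)\<^sup>2"
      using N by simp
    let ?k = "d\<^sup>2 * k + 2 * c * d * l + c\<^sup>2 * m"
    let ?l = "b * d * k + (a * d + b * c) * l + a * c * m"
    let ?m = "b\<^sup>2 * k + 2 * a * b * l + a\<^sup>2 * m"
    \<comment> \<open>A single factor \<open>N\<close> clears the denominators of \<open>u'\<close>,
      \<open>v'\<close> and, by \<open>norm\<close>, of the quadratic part.\<close>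
    have "N * (?k * (u'\<^sup>2 - \<sigma> * v'\<^sup>2) - 2 * ?l * u' - 2 * n * v' + ?m) =
        ?k * (N * (u'\<^sup>2 - \<sigma> * v'\<^sup>2)) - 2 * ?l * (u' * N) - 2 * n * (v' * N) + ?m * N"
      by algebra
    also have "\<dots> = k * (u\<^sup>2 - \<sigma> * v\<^sup>2) - 2 * l * u - 2 * n * v + m"
      unfolding norm u' v' unfolding N_def using det by algebra
    finally have "k * (u\<^sup>2 - \<sigma> * v\<^sup>2) - 2 * l * u - 2 * n * v + m = 0 \<longleftrightarrow>
        ?k * (u'\<^sup>2 - \<sigma> * v'\<^sup>2) - 2 * ?l * u' - 2 * n * v' + ?m = 0"
      using N by (metis mult_eq_0_iff)
    moreover have "point e0 e1 u' v' \<in> plane e0 e1"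
      by (auto simp: plane_def)
    ultimately show ?thesis
      by (simp add: g C moebius_cycle_def point_in_cycle_iff [OF cl])
  qed
  then show ?thesis
    by (auto simp: moebius_transforms_def plane_def)
qed

section \<open>Conjugation of the cycle matrix\<close>

text \<open>On the diagonal, \<open>f0 * f0 * f0 = - f0\<close> yields the factor
  \<open>a * d + b * c\<close> for \<open>l\<close>, while \<open>f0 * f1 * f0 = f1\<close> yields
  \<open>a * d - b * c = 1\<close> for \<open>n\<close>. Off the diagonal, anticommutation cancels
  \<open>f1\<close>.\<close>

lemma cycle_matrix_moebius_cycle:
  assumes cl: "is_clifford \<sigma> f0 f1" and det: "a * d - b * c = 1"
  shows "cycle_matrix f0 f1 s (moebius_cycle a b c d C) =
    mat2 (of_real a) (b *\<^sub>R f0) (- c *\<^sub>R f0) (of_real d)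
    ** cycle_matrix f0 f1 s C
    ** mat2 (of_real d) (- b *\<^sub>R f0) (c *\<^sub>R f0) (of_real a)"
proof (cases C)
  case (fields k l n m)
  \<comment> \<open>The determinant condition, in the factor order that \<open>algebra_simps\<close>
    produces.\<close>
  have "a * (d * (n * s)) = n * s + b * (c * (n * s))"
    using det by algebra
  then have sn: "(a * (d * (n * s))) *\<^sub>R f1 = (n * s) *\<^sub>R f1 + (b * (c * (n * s))) *\<^sub>R f1"
    by (simp add: scaleR_left_distrib)
  show ?thesis
    unfolding fields moebius_cycle_def cycle_matrix_def mat2_mult mat2_eq_iff prod.case
    by (simp add: clifford_mult [OF cl] sn of_real_def algebra_simps power2_eq_square)
      (simp flip: scaleR_left_distrib)
qed

text \<open>The right-hand side represents the inverse of \<open>g\<close>: diagonal products are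
  \<open>a * d + b * c\<close> with \<open>b * c\<close> multiplied by \<open>f0 * f0 = -1\<close>,
  hence the determinant, and off-diagonal ones cancel.\<close>

lemma matrix_inv_clifford_rep:
  assumes cl: "is_clifford \<sigma> f0 f1" and det: "a * d - b * c = 1"
  shows "matrix_inv (clifford_rep f0 (mat2 a b c d)) =
    mat2 (of_real d) (- b *\<^sub>R f0) (c *\<^sub>R f0) (of_real a)"
proof (rule matrix_inv_eqI)
  have "(a * d) *\<^sub>R (1::'a) - (b * c) *\<^sub>R 1 = 1"
    using det by (simp flip: scaleR_left_diff_distrib)
  then show
    "clifford_rep f0 (mat2 a b c d) ** mat2 (of_real d) (- b *\<^sub>R f0) (c *\<^sub>R f0) (of_real a) = mat 1"
    "mat2 (of_real d) (- b *\<^sub>R f0) (c *\<^sub>R f0) (of_real a) ** clifford_rep f0 (mat2 a b c d) = mat 1"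
    by (simp_all add: clifford_rep_def mat2_nth mat2_mult mat2_eq_iff clifford_mult [OF cl]
        of_real_def algebra_simps flip: mat2_one)
qed

theorem proposition3p1:
  fixes \<sigma> \<sigma>' s :: real
    and e0 e1 :: "'a::real_algebra_1"
    and f0 f1 :: "'b::real_algebra_1"
    and a b c d k l n m :: real
    and g :: "real^2^2"
  assumes "\<sigma> \<in> {-1, 0, 1}" and "\<sigma>' \<in> {-1, 0, 1}" and "s \<in> {-1, 0, 1}"
    and "is_clifford \<sigma> e0 e1"
    and "is_clifford \<sigma>' f0 f1"
    and "g = mat2 a b c d" and "det g = 1"
    and "(k, l, n, m) \<noteq> (0, 0, 0, 0)"
  shows "\<exists>k' l' n' m'.
     (k', l', n', m') \<noteq> (0, 0, 0, 0) \<and>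
     moebius_transforms e0 e1 g (cycle \<sigma> e0 e1 (k, l, n, m)) (cycle \<sigma> e0 e1 (k', l', n', m')) \<and>
     cycle_matrix f0 f1 s (k', l', n', m') =
       mat2 (of_real a) (b *\<^sub>R f0) (- c *\<^sub>R f0) (of_real d)
       ** cycle_matrix f0 f1 s (k, l, n, m)
       ** mat2 (of_real d) (- b *\<^sub>R f0) (c *\<^sub>R f0) (of_real a) \<and>
     cycle_matrix f0 f1 s (k', l', n', m') =
       clifford_rep f0 g ** cycle_matrix f0 f1 s (k, l, n, m) ** matrix_inv (clifford_rep f0 g)"
proof -
  have det: "a * d - b * c = 1"
    using assms(6,7) by (simp add: det_2 mat2_nth)
  obtain k' l' n' m' where C': "moebius_cycle a b c d (k, l, n, m) = (k', l', n', m')"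
    by (metis prod.exhaust)
  have "(k', l', n', m') \<noteq> (0, 0, 0, 0)"
  proof
    assume "(k', l', n', m') = (0, 0, 0, 0)"
    \<comment> \<open>The inverse map is linear, so a zero image would force the original
      coefficients to vanish.\<close>
    then have "(k, l, n, m) = moebius_cycle d (- b) (- c) a (0, 0, 0, 0)"
      using moebius_cycle_inverse [OF det] C' by metis
    with assms(8) show False
      by (simp add: moebius_cycle_def)
  qed
  moreover have "moebius_transforms e0 e1 g (cycle \<sigma> e0 e1 (k, l, n, m))
      (cycle \<sigma> e0 e1 (k', l', n', m'))"
    using moebius_transforms_cycle [OF assms(4) det] by (metis C' assms(6))
  moreover note cycle_matrix_moebius_cycle [OF assms(5) det, of s "(k, l, n, m)", unfolded C']
  moreover have "clifford_rep f0 g = mat2 (of_real a) (b *\<^sub>R f0) (- c *\<^sub>R f0) (of_real d)"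
    by (simp add: clifford_rep_def assms(6) mat2_nth)
  moreover have "matrix_inv (clifford_rep f0 g) =
      mat2 (of_real d) (- b *\<^sub>R f0) (c *\<^sub>R f0) (of_real a)"
    using matrix_inv_clifford_rep [OF assms(5) det] by (simp add: assms(6))
  ultimately show ?thesis
    by metis
qed

end
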